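(* Suppose that $\bar\tau_{k,l}>0$ for all $1\le k\le m$, $1\le l\le n$. Then the alternating algorithm (Steps M0–M3) described in the context has the property of locally linear convergence. That is, there exist positive constants $c$ and $d$ such that if $$\|\boldsymbol{\mu}^{(0)}-\boldsymbol{\mu}^{*}\|\le c\quad\text{and}\quad \|\boldsymbol{\lambda}^{(0)}-\boldsymbol{\lambda}^{*}\|\le d,$$ then the sequences $\boldsymbol{\mu}^{(t)}$ and $\boldsymbol{\lambda}^{(t)}$ $(t=0,1,\ldots)$ generated by the algorithm converge to the solutions $\boldsymbol{\mu}^{*}$ and $\boldsymbol{\lambda}^{*}$, respectively, where $(\boldsymbol{\mu}^{*},\boldsymbol{\lambda}^{*})$ is a solution of the Lagrange system given in the context. Moreover, convergence is attained with the convergence rates $$\|\boldsymbol{\mu}^{(t)}-\boldsymbol{\mu}^{*}\|=O(\nu^t),\qquad \|\boldsymbol{\lambda}^{(t)}-\boldsymbol{\lambda}^{*}\|=O(\nu^t)\qquad\text{as } t\to\infty,$$ for a positive constant $\nu\in(0,1)$, and the constants $c$, $d$ and $\nu$ depend on $(\boldsymbol{\mu}^{*},\boldsymbol{\lambda}^{*})$.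
   Context: Setting. Let $m,n\ge1$ be integers. The algorithm is the M-step of an EM algorithm for estimating the $m\times n$ parameter matrix $R=(r_{k,l})$ of the Bernstein copula. Here $\bar\tau_{k,l}=\frac1N\sum_{i=1}^N\widehat\tau_{i,k,l}$ is an average over $N$ observations of nonnegative posterior weights $\widehat\tau_{i,k,l}$ with $\sum_{k,l}\widehat\tau_{i,k,l}=1$ for each $i$, so $\bar\tau_{k,l}\ge 0$ and $\sum_{k,l}\bar\tau_{k,l}=1$. The M-step maximizes $\sum_{k,l}\bar\tau_{k,l}\log r_{k,l}$ over matrices with $r_{k,l}\ge0$, $\sum_{l} r_{k,l}=1/m$ for all $k$ and $\sum_k r_{k,l}=1/n$ for all $l$. With Lagrange multipliers $\mu_k,\lambda_l$, the maximizer has the form $r_{k,l}=\bar\tau_{k,l}/(\mu_k+\lambda_l)>0$. The solutions $\boldsymbol{\mu}^{*}=(\mu_1^*,\ldots,\mu_m^* )'$ and $\boldsymbol{\lambda}^{*}=(\lambda_1^*,\ldots,\lambda_n^* )'$ are the multipliers solving the Lagrange system $$\mu_k^*+\lambda_l^*>0,\qquad \sum_{l=1}^n\frac{\bar\tau_{k,l}}{\mu_k^*+\lambda_l^*}=\frac1m,\qquad \sum_{k=1}^m\frac{\bar\tau_{k,l}}{\mu_k^*+\lambda_l^*}=\frac1n\qquad(1\le k\le m,\ 1\le l\le n).$$ If $(\mu_k),(\lambda_l)$ is a solution, then so is $(\mu_k+a),(\lambda_l-a)$ for every constant $a\in\mathbb{R}$; Step M3 below is included in the algorithm to remove this redundancy.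 The algorithm. Step M0: Set an initial vector $\boldsymbol{\mu}^{(0)}=(\mu_1^{(0)},\ldots,\mu_m^{(0)})'$ and $t=0$. Step M1: Given $\boldsymbol{\mu}^{(t)}$, for each $1\le l\le n$ let $\lambda_l^{(t)}$ be the unique solution $\lambda_l$ of $$\sum_{k=1}^m\frac{\bar\tau_{k,l}}{\mu_k^{(t)}+\lambda_l}=\frac1n\quad\text{with}\quad \lambda_l>-\min_k \mu_k^{(t)};$$ put $\boldsymbol{\lambda}^{(t)}=(\lambda_1^{(t)},\ldots,\lambda_n^{(t)})'$. (Thus $\boldsymbol{\lambda}^{(0)}$ is computed from $\boldsymbol{\mu}^{(0)}$ in the first execution of this step.) Step M2: Given $\boldsymbol{\lambda}^{(t)}$, for each $1\le k\le m$ let $\widetilde\mu_k^{(t+1)}$ be the unique solution $\widetilde\mu_k$ of $$\sum_{l=1}^n\frac{\bar\tau_{k,l}}{\widetilde\mu_k+\lambda_l^{(t)}}=\frac1m\quad\text{with}\quad \widetilde\mu_k>-\min_l\lambda_l^{(t)}.$$ Step M3: Set $$\mu_k^{(t+1)}=\widetilde\mu_k^{(t+1)}-\frac1m\Bigl(\sum_{j=1}^m\widetilde\mu_j^{(t+1)}-\sum_{j=1}^m\mu_j^{(0)}\Bigr),\qquad 1\le k\le m,$$ so that $\sum_k\mu_k^{(t+1)}=\sum_k\mu_k^{(0)}$. Increase $t$ by $1$ and return to Step M1, repeating until convergence. $\|\cdot\|$ denotes a vector norm.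
   Formalization: Since Step M3 preserves the sum of μ^(0), the limit is the shifted solution (μ*+a, λ*−a) with a = (Σμ^(0) − Σμ* )/m; it is (μ*, λ* ) itself exactly when the sums agree. As worded the claim fails, e.g. for μ^(0) = μ*+a, a ≠ 0 small. *)

theory Defs
  imports "HOL-Analysis.Analysis" "HOL-Library.Landau_Symbols"
begin

text \<open>Vectors indexed by \<open>k = 1..m\<close> have type \<open>real ^ 'm\<close>, those indexed by
  \<open>l = 1..n\<close> have type \<open>real ^ 'n\<close>, and \<open>tau $ k $ l\<close> is the averaged posterior weight of the
  cell \<open>(k, l)\<close>.\<close>

definition vector_norm :: "('v::real_vector \<Rightarrow> real) \<Rightarrow> bool" where
  "vector_norm N \<longleftrightarrow>
     (\<forall>x. 0 \<le> N x) \<and>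
     (\<forall>x. N x = 0 \<longleftrightarrow> x = 0) \<and>
     (\<forall>a x. N (a *\<^sub>R x) = \<bar>a\<bar> * N x) \<and>
     (\<forall>x y. N (x + y) \<le> N x + N y)"

definition lagrange_solution :: "real ^ 'n ^ 'm \<Rightarrow> real ^ 'm \<Rightarrow> real ^ 'n \<Rightarrow> bool" where
  "lagrange_solution tau mu lam \<longleftrightarrow>
     (\<forall>k l. mu $ k + lam $ l > 0) \<and>
     (\<forall>k. (\<Sum>l\<in>UNIV. tau $ k $ l / (mu $ k + lam $ l)) = 1 / real CARD('m)) \<and>
     (\<forall>l. (\<Sum>k\<in>UNIV. tau $ k $ l / (mu $ k + lam $ l)) = 1 / real CARD('n))"

text \<open>If all entries of \<open>tau\<close> are positive, each of the two descriptions below has exactly one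
  solution: on the indicated half-line the left-hand side decreases strictly from infinity
  to 0.\<close>

definition stepM1 :: "real ^ 'n ^ 'm \<Rightarrow> real ^ 'm \<Rightarrow> real ^ 'n" where
  "stepM1 tau mu =
     (\<chi> l. THE x. x > - (MIN k. mu $ k) \<and>
                  (\<Sum>k\<in>UNIV. tau $ k $ l / (mu $ k + x)) = 1 / real CARD('n))"

definition stepM2 :: "real ^ 'n ^ 'm \<Rightarrow> real ^ 'n \<Rightarrow> real ^ 'm" where
  "stepM2 tau lam =
     (\<chi> k. THE x. x > - (MIN l. lam $ l) \<and>
                  (\<Sum>l\<in>UNIV. tau $ k $ l / (x + lam $ l)) = 1 / real CARD('m))"

definition stepM3 :: "real ^ 'm \<Rightarrow> real ^ 'm \<Rightarrow> real ^ 'm" where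
  "stepM3 mu0 mut =
     (\<chi> k. mut $ k - 1 / real CARD('m) * ((\<Sum>j\<in>UNIV. mut $ j) - (\<Sum>j\<in>UNIV. mu0 $ j)))"

primrec mu_seq :: "real ^ 'n ^ 'm \<Rightarrow> real ^ 'm \<Rightarrow> nat \<Rightarrow> real ^ 'm" where
  "mu_seq tau mu0 0 = mu0"
| "mu_seq tau mu0 (Suc t) = stepM3 mu0 (stepM2 tau (stepM1 tau (mu_seq tau mu0 t)))"

definition lam_seq :: "real ^ 'n ^ 'm \<Rightarrow> real ^ 'm \<Rightarrow> nat \<Rightarrow> real ^ 'n" where
  "lam_seq tau mu0 t = stepM1 tau (mu_seq tau mu0 t)"

text \<open>The Lagrange system determines \<open>(mu, lam)\<close> only up to \<open>(mu + a, lam - a)\<close>, while step M3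
  keeps the coordinate sum of \<open>mu\<close> at its initial value. The limit can therefore only be the
  representative of the class of a given solution \<open>(mu, lam)\<close> whose first component has the same
  coordinate sum as \<open>mu0\<close>; \<open>offset mu0 mu\<close> is the constant \<open>a\<close> leading to it, and it
  vanishes if \<open>mu\<close> itself already has that sum.\<close>

definition offset :: "real ^ 'm \<Rightarrow> real ^ 'm \<Rightarrow> real" where
  "offset mu0 mu = ((\<Sum>k\<in>UNIV. mu0 $ k) - (\<Sum>k\<in>UNIV. mu $ k)) / real CARD('m)"

definition mu_limit :: "real ^ 'm \<Rightarrow> real ^ 'm \<Rightarrow> real ^ 'm" where
  "mu_limit mu0 mu = (\<chi> k. mu $ k + offset mu0 mu)"

definition lam_limit :: "real ^ 'm \<Rightarrow> real ^ 'm \<Rightarrow> real ^ 'n \<Rightarrow> real ^ 'n" where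
  "lam_limit mu0 mu lam = (\<chi> l. lam $ l - offset mu0 mu)"

lemma limit_normalized:
  assumes "(\<Sum>k\<in>UNIV. mu0 $ k) = (\<Sum>k\<in>UNIV. mu $ k)"
  shows "mu_limit mu0 mu = mu" and "lam_limit mu0 mu lam = lam"
  using assms by (simp_all add: mu_limit_def lam_limit_def offset_def vec_eq_iff)

lemma lagrange_solution_limit:
  "lagrange_solution tau mu lam \<Longrightarrow> lagrange_solution tau (mu_limit mu0 mu) (lam_limit mu0 mu lam)"
  by (simp add: lagrange_solution_def mu_limit_def lam_limit_def)

lemma sum_mu_limit: "(\<Sum>k\<in>UNIV. mu_limit mu0 mu $ k) = (\<Sum>k\<in>UNIV. mu0 $ k)"
  by (simp add: mu_limit_def offset_def sum.distrib)

end

theory Submission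
  imports Defs
begin

text \<open>Write \<open>u = mu - mu*\<close> and \<open>v = lam - lam*\<close>. Subtracting the equations satisfied by
  \<open>lam\<close> and \<open>lam*\<close> gives \<open>\<Sum>k. w k l * (u k + v l) = 0\<close> with the positive weights
  \<open>w k l = tau k l / ((mu k + lam l) * (mu* k + lam* l))\<close>, so that \<open>- v l\<close> is a weighted mean
  of the \<open>u k\<close>. The weights are bounded away from zero, hence each half step contracts the
  oscillation by a fixed factor, and step M3 does not change the oscillation. As M3 fixes the
  coordinate sum, the error with respect to the normalised solution has sum zero and is
  bounded by its oscillation.\<close>

section \<open>Weighted means and the loss of oscillation in a half step\<close>

text \<open>As \<open>- v\<close> is the weighted mean of \<open>u\<close>, \<open>b + v\<close> is
  the mean of the nonnegative gaps \<open>b - u k\<close>; the single term \<open>j\<close>, of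
  relative weight at least \<open>\<epsilon>\<close>, bounds it from below.\<close>

lemma weighted_mean_upper:
  fixes w u :: "'k::finite \<Rightarrow> real"
  assumes w: "\<And>k. w k > 0"
    and zero: "(\<Sum>k\<in>UNIV. w k * (u k + v)) = 0"
    and le: "\<And>k. u k \<le> b"
    and eps: "\<epsilon> * (\<Sum>k\<in>UNIV. w k) \<le> w j"
  shows "\<epsilon> * (b - u j) \<le> b + v"
proof -
  have W: "(\<Sum>k\<in>UNIV. w k) > 0"
    using w by (intro sum_pos) auto
  have "\<epsilon> * (\<Sum>k\<in>UNIV. w k) * (b - u j) \<le> w j * (b - u j)"
    using eps le[of j] by (intro mult_right_mono) auto
  also have "\<dots> \<le> (\<Sum>k\<in>UNIV. w k * (b - u k))"
    using w le by (intro member_le_sum) (auto simp: less_imp_le)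
  also have "\<dots> = (\<Sum>k\<in>UNIV. w k * (b + v) - w k * (u k + v))"
    by (intro sum.cong) (auto simp: algebra_simps)
  also have "\<dots> = (\<Sum>k\<in>UNIV. w k) * (b + v)"
    using zero by (simp add: sum_subtractf sum_distrib_right)
  finally have "(\<Sum>k\<in>UNIV. w k) * (\<epsilon> * (b - u j)) \<le> (\<Sum>k\<in>UNIV. w k) * (b + v)"
    by (simp add: mult_ac)
  with W show ?thesis by simp
qed

lemma weighted_mean_le:
  fixes w u :: "'k::finite \<Rightarrow> real"
  assumes "\<And>k. w k > 0" "(\<Sum>k\<in>UNIV. w k * (u k + v)) = 0" "\<And>k. u k \<le> b"
  shows "- v \<le> b"
  using weighted_mean_upper[of w u v b 0] assms by (simp add: less_imp_le)

lemma weighted_mean_ge: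
  fixes w u :: "'k::finite \<Rightarrow> real"
  assumes "\<And>k. w k > 0" "(\<Sum>k\<in>UNIV. w k * (u k + v)) = 0" "\<And>k. a \<le> u k"
  shows "a \<le> - v"
proof -
  have "(\<Sum>k\<in>UNIV. w k * (- u k + - v)) = - (\<Sum>k\<in>UNIV. w k * (u k + v))"
    by (simp add: sum_negf[symmetric] algebra_simps)
  then show ?thesis
    using weighted_mean_le[of w "\<lambda>k. - u k" "- v" "- a"] assms by simp
qed

text \<open>One-sided Doeblin argument: the smallest value \<open>u j\<close> has relative weight at
  least \<open>\<epsilon>\<close> in every mean, so each mean \<open>- v l'\<close> stays below the
  maximum \<open>u i\<close> by \<open>\<epsilon> * (u i - u j)\<close>, while no mean falls below
  \<open>u j\<close>.\<close>

lemma weighted_means_contract: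
  fixes w :: "'k::finite \<Rightarrow> 'l \<Rightarrow> real" and u :: "'k \<Rightarrow> real"
  assumes w: "\<And>k l. w k l > 0"
    and zero: "\<And>l. (\<Sum>k\<in>UNIV. w k l * (u k + v l)) = 0"
    and eps: "\<And>k l. \<epsilon> * (\<Sum>k\<in>UNIV. w k l) \<le> w k l" "\<epsilon> \<le> 1"
    and r: "\<And>i j. u i - u j \<le> r"
  shows "v l - v l' \<le> (1 - \<epsilon>) * r"
proof -
  have "Max (range u) \<in> range u" "Min (range u) \<in> range u"
    by (auto intro!: Max_in Min_in)
  then obtain i j where ij: "Max (range u) = u i" "Min (range u) = u j" by blast
  have i: "u k \<le> u i" and j: "u j \<le> u k" for k
    using Max_ge[of "range u" "u k"] Min_le[of "range u" "u k"] ij by auto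
  have "\<epsilon> * (u i - u j) \<le> u i + v l'"
    using w zero i eps(1) by (rule weighted_mean_upper)
  moreover have "u j \<le> - v l"
    using w zero j by (rule weighted_mean_ge)
  ultimately have "v l - v l' \<le> (1 - \<epsilon>) * (u i - u j)"
    by (simp add: algebra_simps)
  also have "\<dots> \<le> (1 - \<epsilon>) * r"
    using eps(2) r by (intro mult_left_mono) auto
  finally show ?thesis .
qed

text \<open>Serves M1 and, with rows and columns exchanged, M2. The first conclusion controls the
  displacement of \<open>y\<close>; the second uses it to keep the denominators below
  \<open>B\<close>, which bounds the relative weights from below.\<close>

lemma
  fixes T :: "'k::finite \<Rightarrow> 'l \<Rightarrow> real" and x x' :: "'k \<Rightarrow> real" and y y' :: "'l \<Rightarrow> real"
  assumes T: "\<And>k l. e \<le> T k l" "\<And>k l. T k l \<le> 1" and e: "e > 0"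
    and pos: "\<And>k l. x k + y l > 0" "\<And>k l. x' k + y' l > 0"
    and eq: "\<And>l. (\<Sum>k\<in>UNIV. T k l / (x k + y l)) = c"
            "\<And>l. (\<Sum>k\<in>UNIV. T k l / (x' k + y' l)) = c"
    and c: "c \<le> 1"
    and s: "\<And>k. \<bar>x k - x' k\<bar> \<le> s"
  shows half_step_abs_le: "\<bar>y l - y' l\<bar> \<le> s"
    and half_step_contract:
      "\<lbrakk>\<And>k l. x' k + y' l + 2 * s \<le> B; \<And>i j. (x i - x' i) - (x j - x' j) \<le> r;
        \<epsilon> * (real CARD('k) * B\<^sup>2) \<le> e ^ 3; 0 \<le> \<epsilon>; \<epsilon> \<le> 1\<rbrakk>
       \<Longrightarrow> (y l - y' l) - (y l' - y' l') \<le> (1 - \<epsilon>) * r"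
proof -
  define w where "w k l = T k l / ((x k + y l) * (x' k + y' l))" for k l
  have T_pos: "T k l > 0" for k l using T(1)[of k l] e by linarith
  have w_pos: "w k l > 0" for k l
    unfolding w_def using T_pos pos by simp
  \<comment> \<open>The identity \<open>1/z' - 1/z = (z - z')/(z * z')\<close> makes this exact,
    without linearisation error. The weights depend on the iterate, hence the uniform bounds
    below.\<close>
  have zero: "(\<Sum>k\<in>UNIV. w k l * ((x k - x' k) + (y l - y' l))) = 0" for l
  proof -
    have "w k l * ((x k - x' k) + (y l - y' l)) = T k l / (x' k + y' l) - T k l / (x k + y l)" for k
      using pos[of k l] unfolding w_def by (simp add: field_simps)
    then show ?thesis by (simp add: sum_subtractf eq)
  qed
  have abs_le: "\<bar>y l - y' l\<bar> \<le> s" for l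
  proof -
    have "x k - x' k \<le> s" "- s \<le> x k - x' k" for k
      using s[of k] by auto
    then show ?thesis
      using weighted_mean_le[OF w_pos zero, of s l] weighted_mean_ge[OF w_pos zero, of "- s" l]
      by auto
  qed
  show "\<bar>y l - y' l\<bar> \<le> s" by (rule abs_le)
  show "(y l - y' l) - (y l' - y' l') \<le> (1 - \<epsilon>) * r"
    if B: "\<And>k l. x' k + y' l + 2 * s \<le> B" and r: "\<And>i j. (x i - x' i) - (x j - x' j) \<le> r"
      and eps: "\<epsilon> * (real CARD('k) * B\<^sup>2) \<le> e ^ 3" "0 \<le> \<epsilon>" "\<epsilon> \<le> 1"
  proof -
    \<comment> \<open>A summand is at most \<open>c \<le> 1\<close>, so its denominator is at least
      its numerator, which is at least \<open>e\<close>.\<close>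
    have lower: "e \<le> z"
      if "T k l / z \<le> c" "z > 0" for k l z
    proof -
      have "T k l / z \<le> 1" using that c by linarith
      then have "T k l \<le> z" using that by (simp add: field_simps)
      then show ?thesis using T(1)[of k l] by linarith
    qed
    have "T k l / (x k + y l) \<le> c" for k l
      unfolding eq(1)[of l, symmetric]
      using T_pos pos by (intro member_le_sum) (auto simp: less_imp_le)
    then have lo: "e \<le> x k + y l" for k l using lower pos by blast
    have "T k l / (x' k + y' l) \<le> c" for k l
      unfolding eq(2)[of l, symmetric]
      using T_pos pos by (intro member_le_sum) (auto simp: less_imp_le)
    then have lo': "e \<le> x' k + y' l" for k l using lower pos by blast
    \<comment> \<open>Both \<open>x\<close> and \<open>y\<close> are within \<open>s\<close> of
      \<open>x'\<close> and \<open>y'\<close>, which accounts for the \<open>2 * s\<close>.\<close>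
    have up: "x k + y l \<le> B" for k l
      using B[of k l] s[of k] abs_le[of l] by linarith
    have up': "x' k + y' l \<le> B" for k l
      using B[of k l] s[of k] by linarith
    have B_pos: "B > 0" using pos(2) up' by (meson less_le_trans)
    have w_le: "w k l \<le> 1 / e\<^sup>2" for k l
      unfolding w_def power2_eq_square using T T_pos lo lo' e
      by (intro frac_le mult_mono) (auto simp: less_imp_le pos)
    have w_ge: "e / B\<^sup>2 \<le> w k l" for k l
      unfolding w_def power2_eq_square using T T_pos up up' e B_pos
      by (intro frac_le mult_mono mult_pos_pos) (auto simp: less_imp_le pos)
    \<comment> \<open>The weights lie between \<open>e / B\<^sup>2\<close> and
      \<open>1 / e\<^sup>2\<close>; the ratio of these bounds is the source of
      \<open>e ^ 3\<close>.\<close>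
    have "\<epsilon> * (\<Sum>k\<in>UNIV. w k l) \<le> w k l" for k l
    proof -
      have "(\<Sum>k\<in>UNIV. w k l) \<le> real CARD('k) * (1 / e\<^sup>2)"
        using sum_bounded_above[of UNIV "\<lambda>k. w k l" "1 / e\<^sup>2"] w_le by simp
      then have "\<epsilon> * (\<Sum>k\<in>UNIV. w k l) \<le> \<epsilon> * (real CARD('k) * (1 / e\<^sup>2))"
        using eps by (intro mult_left_mono) auto
      also have "\<dots> \<le> e / B\<^sup>2"
        using eps(1) B_pos e by (simp add: field_simps power2_eq_square power3_eq_cube)
      finally show ?thesis using w_ge[of k l] by linarith
    qed
    then show ?thesis
      by (rule weighted_means_contract[OF w_pos zero _ eps(3) r])
  qed
qed

section \<open>Unique solvability of the equations in M1 and M2\<close>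

text \<open>Right of its largest pole the sum is continuous and strictly decreasing; existence
  follows from the intermediate value theorem on an explicit bracket.\<close>

lemma ex1_secular_equation:
  fixes a x :: "'k::finite \<Rightarrow> real"
  assumes a: "\<And>k. a k > 0" and c: "c > 0"
  shows "\<exists>!y. y > - (MIN k. x k) \<and> (\<Sum>k\<in>UNIV. a k / (x k + y)) = c"
proof -
  let ?m = "MIN k. x k"
  let ?f = "\<lambda>y. \<Sum>k\<in>UNIV. a k / (x k + y)"
  have "?m \<in> range x" by (intro Min_in) auto
  then obtain j where j: "?m = x j" by blast
  have min: "?m \<le> x k" for k by (intro Min_le) auto
  have pos: "x k + y > 0" if "y > - ?m" for y k using min[of k] that by linarith
  have A: "sum a UNIV > 0" using a by (intro sum_pos) auto
  \<comment> \<open>At \<open>?p\<close> the term with the smallest \<open>x j\<close> alone equals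
    \<open>c\<close>; at \<open>?q\<close> every denominator is at least
    \<open>sum a UNIV / c\<close>, so the sum is at most \<open>c\<close>.\<close>
  let ?p = "a j / c - ?m" and ?q = "sum a UNIV / c - ?m"
  have aj: "a j \<le> sum a UNIV" using a by (intro member_le_sum) (auto simp: less_imp_le)
  have p: "?p > - ?m" and q: "?q > - ?m"
    using divide_pos_pos[OF a[of j] c] divide_pos_pos[OF A c] by linarith+
  have pq: "?p \<le> ?q" using aj c by (simp add: divide_right_mono)
  have "c = a j / (x j + ?p)" using j a[of j] c by simp
  also have "\<dots> \<le> ?f ?p"
    using a pos[OF p] by (intro member_le_sum) (auto simp: less_imp_le)
  finally have fp: "c \<le> ?f ?p" .
  have "?f ?q \<le> (\<Sum>k\<in>UNIV. a k / (sum a UNIV / c))"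
  proof (intro sum_mono divide_left_mono)
    fix k
    show "sum a UNIV / c \<le> x k + ?q" using min[of k] by linarith
    show "0 < (x k + ?q) * (sum a UNIV / c)" using pos[OF q] A c by simp
  qed (use a in \<open>simp add: less_imp_le\<close>)
  also have "\<dots> = c" using A by (simp add: sum_divide_distrib[symmetric] sum_distrib_right[symmetric])
  finally have fq: "?f ?q \<le> c" .
  have "continuous_on {?p..?q} ?f"
  proof (intro continuous_intros ballI)
    fix k y assume "y \<in> {?p..?q}"
    then have "y > - ?m" using p less_le_trans unfolding atLeastAtMost_iff by blast
    then show "x k + y \<noteq> 0" using pos[of y k] by simp
  qed
  then obtain y where "?p \<le> y" "y \<le> ?q" "?f y = c"
    using IVT2'[of ?f ?q c ?p] fp fq pq by blast
  then have y: "y > - ?m \<and> ?f y = c" using less_le_trans[OF p] by blast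
  have dec: "?f z < ?f y" if "y < z" "y > - ?m" for y z
    using that(1) a pos[OF that(2)] pos[OF less_trans[OF that(2,1)]]
    by (intro sum_strict_mono divide_strict_left_mono mult_pos_pos) auto
  show ?thesis
  proof (rule ex1I, rule y)
    fix z assume "z > - ?m \<and> ?f z = c"
    then show "z = y" using y dec[of y z] dec[of z y] by (cases y z rule: linorder_cases) auto
  qed
qed

text \<open>Unique solvability lets the \<open>THE\<close> in \<open>stepM1\<close> be replaced by
  its defining property; lying right of the negated minimum makes every denominator
  positive.\<close>

lemma
  fixes tau :: "real ^ 'n ^ 'm"
  assumes "\<And>k l. tau $ k $ l > 0"
  shows stepM1_pos: "mu $ k + stepM1 tau mu $ l > 0"
    and stepM1_eq: "(\<Sum>k\<in>UNIV. tau $ k $ l / (mu $ k + stepM1 tau mu $ l)) = 1 / real CARD('n)"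
proof -
  have *: "stepM1 tau mu $ l > - (MIN k. mu $ k) \<and>
     (\<Sum>k\<in>UNIV. tau $ k $ l / (mu $ k + stepM1 tau mu $ l)) = 1 / real CARD('n)"
    unfolding stepM1_def vec_lambda_beta
    by (rule theI'[OF ex1_secular_equation]) (use assms in auto)
  moreover have "(MIN k. mu $ k) \<le> mu $ k" by (intro Min_le) auto
  ultimately show "mu $ k + stepM1 tau mu $ l > 0" by linarith
  from * show "(\<Sum>k\<in>UNIV. tau $ k $ l / (mu $ k + stepM1 tau mu $ l)) = 1 / real CARD('n)"
    by blast
qed

text \<open>Reduces all facts about M2 to those about M1.\<close>

lemma stepM2_transpose: "stepM2 tau lam = stepM1 (transpose tau) lam"
  by (simp add: stepM1_def stepM2_def transpose_def add.commute)

lemma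
  fixes tau :: "real ^ 'n ^ 'm"
  assumes "\<And>k l. tau $ k $ l > 0"
  shows stepM2_pos: "lam $ l + stepM2 tau lam $ k > 0"
    and stepM2_eq: "(\<Sum>l\<in>UNIV. tau $ k $ l / (lam $ l + stepM2 tau lam $ k)) = 1 / real CARD('m)"
  using stepM1_pos[of "transpose tau" lam l k] stepM1_eq[of "transpose tau" k lam] assms
  by (simp_all add: stepM2_transpose transpose_def)

text \<open>Zero is the mean of \<open>u\<close> with unit weights, so it lies within
  \<open>r\<close> of each \<open>u k\<close>. This turns oscillation bounds into coordinate
  bounds.\<close>

lemma abs_le_spread_if_sum_zero:
  fixes u :: "'k::finite \<Rightarrow> real"
  assumes "\<And>i j. u i - u j \<le> r" "sum u UNIV = 0"
  shows "\<bar>u k\<bar> \<le> r"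
proof -
  have "u k \<le> r"
    using weighted_mean_ge[of "\<lambda>_. 1" u 0 "u k - r"] assms by (simp add: algebra_simps)
  moreover have "- u k \<le> r"
    using weighted_mean_le[of "\<lambda>_. 1" u 0 "u k + r"] assms by (simp add: algebra_simps)
  ultimately show ?thesis by linarith
qed

lemma sum_stepM3:
  fixes mu0 mut :: "real ^ 'm"
  shows "(\<Sum>k\<in>UNIV. stepM3 mu0 mut $ k) = (\<Sum>k\<in>UNIV. mu0 $ k)"
  by (simp add: stepM3_def sum_subtractf)

text \<open>A case split replaces induction, since M3 restores the sum of \<open>mu0\<close> itself
  and not that of the preceding iterate.\<close>

lemma sum_mu_seq: "(\<Sum>k\<in>UNIV. mu_seq tau mu0 t $ k) = (\<Sum>k\<in>UNIV. mu0 $ k)"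
  by (cases t) (simp_all add: sum_stepM3)

section \<open>Arbitrary vector norms compared with coordinates\<close>

context
  fixes N :: "real ^ 'm \<Rightarrow> real"
  assumes N: "vector_norm N"
begin

lemma vector_norm_sum_le: "finite A \<Longrightarrow> N (sum f A) \<le> (\<Sum>i\<in>A. N (f i))"
proof (induction A rule: finite_induct)
  case empty
  have "N 0 = 0" using N unfolding vector_norm_def by blast
  then show ?case by simp
next
  case (insert i A)
  have "N (f i + sum f A) \<le> N (f i) + N (sum f A)"
    using N by (simp add: vector_norm_def)
  with insert show ?case by simp
qed

lemma vector_norm_le_components: "N x \<le> (\<Sum>i\<in>UNIV. \<bar>x $ i\<bar> * N (axis i 1))"
proof -
  have "N x = N (\<Sum>i\<in>UNIV. (x $ i) *\<^sub>R axis i 1)"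
    by (simp add: basis_expansion scalar_mult_eq_scaleR[symmetric])
  also have "\<dots> \<le> (\<Sum>i\<in>UNIV. N ((x $ i) *\<^sub>R axis i 1))"
    by (rule vector_norm_sum_le) simp
  also have "\<dots> = (\<Sum>i\<in>UNIV. \<bar>x $ i\<bar> * N (axis i 1))"
    using N by (simp add: vector_norm_def)
  finally show ?thesis .
qed

text \<open>Basis expansion with one constant for all vectors; it carries coordinate rates over to
  \<open>N\<close>.\<close>

lemma vector_norm_le_uniform: "\<exists>K\<ge>0. \<forall>x r. (\<forall>i. \<bar>x $ i\<bar> \<le> r) \<longrightarrow> N x \<le> K * r"
proof (intro exI[of _ "\<Sum>i\<in>UNIV. N (axis i 1)"] conjI allI impI)
  show "0 \<le> (\<Sum>i\<in>UNIV. N (axis i 1))"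
    using N by (intro sum_nonneg) (simp add: vector_norm_def)
  fix x :: "real ^ 'm" and r :: real
  assume "\<forall>i. \<bar>x $ i\<bar> \<le> r"
  then have "(\<Sum>i\<in>UNIV. \<bar>x $ i\<bar> * N (axis i 1)) \<le> (\<Sum>i\<in>UNIV. r * N (axis i 1))"
    using N by (intro sum_mono mult_right_mono) (auto simp: vector_norm_def)
  then show "N x \<le> (\<Sum>i\<in>UNIV. N (axis i 1)) * r"
    using vector_norm_le_components[of x] by (simp add: sum_distrib_left mult.commute)
qed

text \<open>Equivalence of norms in finite dimension: \<open>N\<close> is Lipschitz, so it attains a
  positive minimum on the compact unit sphere, and homogeneity does the rest. It turns closeness of
  \<open>mu0\<close> in \<open>N\<close> into closeness of coordinates.\<close>

lemma norm_le_vector_norm: "\<exists>C>0. \<forall>x. norm x \<le> C * N x"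
proof -
  obtain K where K: "K \<ge> 0" "\<And>x r. (\<forall>i. \<bar>x $ i\<bar> \<le> r) \<Longrightarrow> N x \<le> K * r"
    using vector_norm_le_uniform by blast
  have N_le: "N x \<le> K * norm x" for x
    using K(2)[of x "norm x"] component_le_norm_cart[of x] by simp
  have tri: "N (x + y) \<le> N x + N y" for x y using N by (simp add: vector_norm_def)
  have "lipschitz_on K UNIV N"
  proof (rule lipschitz_onI)
    fix x y :: "real ^ 'm"
    have "N x \<le> N y + N (x - y)" "N y \<le> N x + N (y - x)"
      using tri[of y "x - y"] tri[of x "y - x"] by auto
    then show "dist (N x) (N y) \<le> K * dist x y"
      using N_le[of "x - y"] N_le[of "y - x"]
      by (simp add: dist_norm norm_minus_commute abs_le_iff)
  qed (rule K(1))
  then have cont: "continuous_on UNIV N" by (rule lipschitz_on_continuous_on)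
  have "sphere (0 :: real ^ 'm) 1 \<noteq> {}" by simp
  then obtain z where z: "z \<in> sphere 0 1" "\<And>x. x \<in> sphere 0 1 \<Longrightarrow> N z \<le> N x"
    using continuous_attains_inf[OF compact_sphere _ continuous_on_subset[OF cont]]
    by (metis subset_UNIV)
  have "z \<noteq> 0" using z(1) by auto
  then have Nz: "N z > 0" using N by (auto simp: vector_norm_def order_less_le)
  have "norm x \<le> 1 / N z * N x" for x
  proof (cases "x = 0")
    case True
    then show ?thesis using N by (simp add: vector_norm_def)
  next
    case False
    have "N z \<le> N ((1 / norm x) *\<^sub>R x)" using False by (intro z(2)) simp
    also have "\<dots> = \<bar>1 / norm x\<bar> * N x" using N by (simp only: vector_norm_def)
    finally show ?thesis using False Nz by (simp add: field_simps)
  qed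
  then show ?thesis using Nz by (intro exI[of _ "1 / N z"]) simp
qed

end

section \<open>From geometric coordinate bounds to limits and rates\<close>

lemma tendsto_if_components_geometric:
  fixes f :: "nat \<Rightarrow> real ^ 'k"
  assumes "\<And>t i. \<bar>(f t - L) $ i\<bar> \<le> \<nu> ^ t * S" "0 \<le> \<nu>" "\<nu> < 1"
  shows "f \<longlonglongrightarrow> L"
proof (rule vec_tendstoI)
  fix i
  have lim: "(\<lambda>t. \<nu> ^ t * S) \<longlonglongrightarrow> 0"
    using assms(2,3) by (intro tendsto_mult_left_zero LIMSEQ_realpow_zero)
  have "(\<lambda>t. f t $ i - L $ i) \<longlonglongrightarrow> 0"
    by (rule Lim_null_comparison[OF _ lim]) (use assms(1)[of _ i] in simp)
  then show "(\<lambda>t. f t $ i) \<longlonglongrightarrow> L $ i" by (simp add: LIM_zero_iff)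
qed

lemma vector_norm_bigo_if_components_geometric:
  fixes f :: "nat \<Rightarrow> real ^ 'k"
  assumes N: "vector_norm N" and f: "\<And>t i. \<bar>f t $ i\<bar> \<le> \<nu> ^ t * S" and "0 \<le> \<nu>"
  shows "(\<lambda>t. N (f t)) \<in> O(\<lambda>t. \<nu> ^ t)"
proof -
  obtain K where K: "\<And>x r. (\<forall>i. \<bar>x $ i\<bar> \<le> r) \<Longrightarrow> N x \<le> K * r"
    using vector_norm_le_uniform[OF N] by blast
  have "norm (N (f t)) \<le> K * S * norm (\<nu> ^ t)" for t
    using K[of "f t" "\<nu> ^ t * S"] f[of t] N assms(3) by (simp add: vector_norm_def mult_ac)
  then show ?thesis by (intro bigoI[of _ "K * S"] always_eventually allI)
qed

section \<open>The contraction constants and the induction along the iterations\<close>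

theorem proposition2p1:
  fixes tau :: "real ^ 'n ^ 'm"
    and mu_star :: "real ^ 'm" and lam_star :: "real ^ 'n"
    and N :: "real ^ 'm \<Rightarrow> real" and N' :: "real ^ 'n \<Rightarrow> real"
  assumes tau_pos: "\<And>k l. tau $ k $ l > 0"
    and tau_sum: "(\<Sum>k\<in>UNIV. \<Sum>l\<in>UNIV. tau $ k $ l) = 1"
    and norms: "vector_norm N" "vector_norm N'"
    and sol: "lagrange_solution tau mu_star lam_star"
  shows "\<exists>c d \<nu>. c > 0 \<and> d > 0 \<and> 0 < \<nu> \<and> \<nu> < 1 \<and>
    (\<forall>mu0. N (mu0 - mu_star) \<le> c \<and> N' (lam_seq tau mu0 0 - lam_star) \<le> d \<longrightarrow>
       mu_seq tau mu0 \<longlonglongrightarrow> mu_limit mu0 mu_star \<and>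
       lam_seq tau mu0 \<longlonglongrightarrow> lam_limit mu0 mu_star lam_star \<and>
       (\<lambda>t. N (mu_seq tau mu0 t - mu_limit mu0 mu_star)) \<in> O(\<lambda>t. \<nu> ^ t) \<and>
       (\<lambda>t. N' (lam_seq tau mu0 t - lam_limit mu0 mu_star lam_star)) \<in> O(\<lambda>t. \<nu> ^ t))"
proof -
  obtain C where C: "C > 0" "\<And>x. norm x \<le> C * N x"
    using norm_le_vector_norm[OF norms(1)] by blast
  \<comment> \<open>Distance 1 in \<open>N\<close> bounds each initial coordinate error by
    \<open>C\<close>, hence the initial oscillation by \<open>2 * C\<close>.\<close>
  define S where "S = 2 * C"
  have S_pos: "S > 0" using C by (simp add: S_def)
  have tau_le: "tau $ k $ l \<le> 1" for k l
  proof -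
    have "tau $ k $ l \<le> (\<Sum>l\<in>UNIV. tau $ k $ l)"
      using tau_pos by (intro member_le_sum) (auto simp: less_imp_le)
    also have "\<dots> \<le> (\<Sum>k\<in>UNIV. \<Sum>l\<in>UNIV. tau $ k $ l)"
      using tau_pos by (intro member_le_sum[of k UNIV "\<lambda>k. \<Sum>l\<in>UNIV. tau $ k $ l"] sum_nonneg)
        (auto simp: less_imp_le)
    finally show ?thesis using tau_sum by simp
  qed
  define e where "e = Min (range (\<lambda>(k, l). tau $ k $ l))"
  have e_le: "e \<le> tau $ k $ l" for k l
    unfolding e_def by (intro Min_le) (auto intro: rev_image_eqI[of "(k, l)"])
  have e_pos: "e > 0"
    unfolding e_def using tau_pos by (subst Min_gr_iff) auto
  have e_le1: "e \<le> 1" using e_le tau_le by (rule order_trans)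
  \<comment> \<open>Upper bound for all denominators met in the iteration: \<open>2 * S\<close>
    covers the displacement of both vectors. Through \<open>B\<close> the rate depends on the
    solution.\<close>
  define B where "B = Max (insert 1 (range (\<lambda>(k, l). mu_star $ k + lam_star $ l + 2 * S)))"
  have B_ge1: "B \<ge> 1" unfolding B_def by (intro Max_ge) auto
  have B_ge: "mu_star $ k + lam_star $ l + 2 * S \<le> B" for k l
    unfolding B_def by (intro Max_ge) (auto intro: rev_image_eqI[of "(k, l)"])
  \<comment> \<open>Dominating both dimensions, \<open>D\<close> allows one
    \<open>\<epsilon>\<close> for both half steps; \<open>D \<ge> 2\<close> makes
    \<open>\<epsilon> < 1\<close> strict.\<close>
  define D where "D = real CARD('m) + real CARD('n)"
  have card: "real CARD('m) \<ge> 1" "real CARD('n) \<ge> 1"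
    by (simp_all add: Suc_le_eq)
  have D: "D \<ge> 2" "real CARD('m) \<le> D" "real CARD('n) \<le> D"
    using card unfolding D_def by linarith+
  define \<epsilon> where "\<epsilon> = e ^ 3 / (D * B\<^sup>2)"
  have DB: "D * B\<^sup>2 \<ge> 2" using D B_ge1 mult_mono[of 2 D 1 "B\<^sup>2"] by (simp add: one_le_power)
  have "e ^ 3 \<le> 1" using e_pos e_le1 by (simp add: power_le_one)
  then have eps: "\<epsilon> > 0" "\<epsilon> < 1"
    using DB e_pos by (simp_all add: \<epsilon>_def field_simps)
  have eps_card: "\<epsilon> * (r * B\<^sup>2) \<le> e ^ 3" if "r \<le> D" for r
  proof -
    have "\<epsilon> * (r * B\<^sup>2) \<le> \<epsilon> * (D * B\<^sup>2)"
      using eps that by (intro mult_left_mono mult_right_mono) auto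
    also have "\<dots> = e ^ 3" unfolding \<epsilon>_def using DB
      by (intro nonzero_eq_divide_eq[THEN iffD1] refl) linarith
    finally show ?thesis .
  qed
  define \<nu> where "\<nu> = 1 - \<epsilon>"
  have nu: "0 < \<nu>" "\<nu> < 1" using eps by (simp_all add: \<nu>_def)

  \<comment> \<open>The radius 1 is a normalisation: the size of the neighbourhood enters through
    \<open>S\<close>, hence through \<open>B\<close> and \<open>\<nu>\<close>.\<close>
  have main: "mu_seq tau mu0 \<longlonglongrightarrow> mu_limit mu0 mu_star \<and>
       lam_seq tau mu0 \<longlonglongrightarrow> lam_limit mu0 mu_star lam_star \<and>
       (\<lambda>t. N (mu_seq tau mu0 t - mu_limit mu0 mu_star)) \<in> O(\<lambda>t. \<nu> ^ t) \<and>
       (\<lambda>t. N' (lam_seq tau mu0 t - lam_limit mu0 mu_star lam_star)) \<in> O(\<lambda>t. \<nu> ^ t)"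
    if mu0: "N (mu0 - mu_star) \<le> 1" for mu0
  proof -
    define M where "M = mu_limit mu0 mu_star"
    define L where "L = lam_limit mu0 mu_star lam_star"
    have "lagrange_solution tau M L"
      unfolding M_def L_def by (rule lagrange_solution_limit[OF sol])
    then have star: "M $ k + L $ l > 0"
        "(\<Sum>l\<in>UNIV. tau $ k $ l / (L $ l + M $ k)) = 1 / real CARD('m)"
        "(\<Sum>k\<in>UNIV. tau $ k $ l / (M $ k + L $ l)) = 1 / real CARD('n)" for k l
      by (simp_all add: lagrange_solution_def add.commute)
    then have star': "L $ l + M $ k > 0" for k l by (simp add: add.commute)
    \<comment> \<open>The offset cancels in \<open>M $ k + L $ l\<close>, so a \<open>B\<close>
      chosen before \<open>mu0\<close> suffices.\<close>
    have star_B: "M $ k + L $ l + 2 * S \<le> B" for k l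
      using B_ge[of k l] by (simp add: M_def L_def mu_limit_def lam_limit_def)
    have sum0: "(\<Sum>k\<in>UNIV. mu_seq tau mu0 t $ k - M $ k) = 0" for t
      by (simp add: sum_subtractf sum_mu_seq M_def sum_mu_limit)
    \<comment> \<open>The induction runs on the oscillation, which sees neither the offset in
      \<open>M\<close> nor the common shift in M3.\<close>
    have spread: "(mu_seq tau mu0 t $ i - M $ i) - (mu_seq tau mu0 t $ j - M $ j) \<le> \<nu> ^ t * S" for t i j
    proof (induction t arbitrary: i j)
      case 0
      let ?u = "mu0 - mu_star"
      have "norm ?u \<le> C"
        using C(2)[of ?u] mult_left_mono[OF mu0, of C] C(1) by linarith
      then have "\<bar>?u $ i\<bar> \<le> C" "\<bar>?u $ j\<bar> \<le> C"
        using component_le_norm_cart order_trans by blast+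
      then have "?u $ i - ?u $ j \<le> S" by (simp add: S_def)
      then show ?case by (simp add: M_def mu_limit_def)
    next
      case (Suc t)
      let ?mu = "mu_seq tau mu0 t"
      let ?lam = "stepM1 tau ?mu"
      let ?mut = "stepM2 tau ?lam"
      let ?r = "\<nu> ^ t * S"
      \<comment> \<open>The errors stay within the initial \<open>S\<close>, so the same
        \<open>B\<close>, and with it the same \<open>\<epsilon>\<close>, serves every
        iteration.\<close>
      have r: "?r \<le> S" using nu S_pos by (simp add: power_le_one mult_left_le_one_le)
      then have B: "M $ k + L $ l + 2 * ?r \<le> B" "L $ l + M $ k + 2 * ?r \<le> B" for k l
        using star_B[of k l] by linarith+
      have u: "\<bar>?mu $ k - M $ k\<bar> \<le> ?r" for k
        by (rule abs_le_spread_if_sum_zero[OF Suc sum0])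
      have v: "\<bar>?lam $ l - L $ l\<bar> \<le> ?r" for l
        by (rule half_step_abs_le[OF e_le tau_le e_pos stepM1_pos[OF tau_pos] star(1)
            stepM1_eq[OF tau_pos] star(3) _ u]) (use card in simp)
      have "(?lam $ l - L $ l) - (?lam $ l' - L $ l') \<le> (1 - \<epsilon>) * ?r" for l l'
        by (rule half_step_contract[OF e_le tau_le e_pos stepM1_pos[OF tau_pos] star(1)
            stepM1_eq[OF tau_pos] star(3) _ u B(1) Suc eps_card[OF D(2)]]) (use card eps in simp_all)
      \<comment> \<open>The gain of the first half step is discarded; only M2 contributes a factor,
        so the rate is \<open>1 - \<epsilon>\<close> and not its square.\<close>
      moreover have "(1 - \<epsilon>) * ?r \<le> ?r"
        using nu S_pos by (intro mult_left_le_one_le) (simp_all add: \<nu>_def)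
      ultimately have v_spread: "(?lam $ l - L $ l) - (?lam $ l' - L $ l') \<le> ?r" for l l'
        by (meson order_trans)
      \<comment> \<open>The half step again, with \<open>L\<close> and \<open>M\<close> exchanged
        and the arguments of \<open>T\<close> swapped.\<close>
      have "(?mut $ i - M $ i) - (?mut $ j - M $ j) \<le> (1 - \<epsilon>) * ?r"
        by (rule half_step_contract[where T = "\<lambda>l k. tau $ k $ l", OF e_le tau_le e_pos
            stepM2_pos[OF tau_pos] star' stepM2_eq[OF tau_pos] star(2) _ v B(2) v_spread eps_card[OF D(3)]])
          (use card eps in simp_all)
      then show ?case by (simp add: stepM3_def \<nu>_def mult_ac)
    qed
    have u: "\<bar>(mu_seq tau mu0 t - M) $ k\<bar> \<le> \<nu> ^ t * S" for t k
      using abs_le_spread_if_sum_zero[OF spread sum0] by simp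
    \<comment> \<open>M1 does not enlarge the largest coordinate error, so \<open>lam_seq\<close>
      inherits the bound of \<open>mu_seq\<close> at the same \<open>t\<close>.\<close>
    have v: "\<bar>(lam_seq tau mu0 t - L) $ l\<bar> \<le> \<nu> ^ t * S" for t l
      unfolding lam_seq_def vector_minus_component
      by (rule half_step_abs_le[OF e_le tau_le e_pos stepM1_pos[OF tau_pos] star(1)
            stepM1_eq[OF tau_pos] star(3) _ u[unfolded vector_minus_component]]) (use card in simp)
    show ?thesis
      using tendsto_if_components_geometric[OF u] tendsto_if_components_geometric[OF v]
        vector_norm_bigo_if_components_geometric[OF norms(1) u]
        vector_norm_bigo_if_components_geometric[OF norms(2) v] nu
      unfolding M_def L_def by simp
  qed
  show ?thesis
    by (intro exI[of _ 1] exI[of _ \<nu>]) (use nu main in auto)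
qed

end
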